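(* Let $G=(K,E)$ be a finite graph with all vertex degrees bounded by $\delta\ge 1$. Let $d\geq 2$ and $r\ge 1$ be integers with $$r\leq \frac{e^{-1}}{2\delta-1}\, d^2 .$$ For every edge $e\in E$ let $P_e$ be an orthogonal projection of rank $r$ on the two-qudit space $\mathbb C^d\otimes\mathbb C^d$ associated with the two endpoints of $e$, extended by the identity to $\bigotimes_{x\in K}\mathbb C^d$, and let $$H_G=\sum_{e\in E}P_e .$$ Then $H_G$ is frustration-free, i.e. $\inf\mathrm{spec}\, H_G=0$.
   Context: Graphs are simple and undirected. A Hamiltonian $H_G=\sum_e P_e$ which is a sum of orthogonal projections is called frustration-free if its smallest eigenvalue is $0$, equivalently $\ker H_G\neq\{0\}$. No relation between the projections $P_e$ on different edges is assumed. *)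

theory Defs
  imports "HOL-Analysis.Analysis"
begin

text \<open>
  Graphs are simple and undirected: the vertex set is a finite type, an edge is a two-element
  set of vertices.
\<close>

definition simple_graph :: "'v set set \<Rightarrow> bool" where
  "simple_graph E \<longleftrightarrow> (\<forall>e\<in>E. card e = 2)"

definition vertex_degree :: "'v set set \<Rightarrow> 'v \<Rightarrow> nat" where
  "vertex_degree E v = card {e \<in> E. v \<in> e}"

definition hermitian_adjoint :: "complex^'n^'m \<Rightarrow> complex^'m^'n" where
  "hermitian_adjoint A = map_matrix cnj (transpose A)"

definition orthogonal_projection :: "complex^'n^'n \<Rightarrow> bool" where
  "orthogonal_projection A \<longleftrightarrow> A ** A = A \<and> hermitian_adjoint A = A"

text \<open>
  With \<open>d = CARD('d)\<close>, the space of two qudits is \<open>complex^('d \<times> 'd)\<close>, and the tensor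
  product of one qudit per vertex is \<open>complex^('v \<Rightarrow> 'd)\<close>: the product basis vectors are indexed
  by the configurations \<open>'v \<Rightarrow> 'd\<close>.

  \<open>extend_op x y A\<close> (meant for \<open>x \<noteq> y\<close>) is the operator acting as \<open>A\<close> on the tensor factors
  \<open>x\<close> (first leg) and \<open>y\<close> (second leg) and as the identity on all others, given by its matrix
  entries in the product basis.
\<close>

definition extend_op ::
  "'v \<Rightarrow> 'v \<Rightarrow> complex^('d \<times> 'd)^('d \<times> 'd) \<Rightarrow> complex^('v::finite \<Rightarrow> 'd::finite)^('v \<Rightarrow> 'd)" where
  "extend_op x y A = (\<chi> \<sigma> \<tau>.
     if \<forall>z. z \<noteq> x \<and> z \<noteq> y \<longrightarrow> \<sigma> z = \<tau> z then A $ (\<sigma> x, \<sigma> y) $ (\<tau> x, \<tau> y) else 0)"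

text \<open>
  An edge \<open>e\<close> is unordered, so identifying the space of its two qudits with
  \<open>complex^('d \<times> 'd)\<close> requires listing its endpoints as a first one \<open>s e\<close> and a second one \<open>t e\<close>.
\<close>

definition endpoint_listing :: "'v set set \<Rightarrow> ('v set \<Rightarrow> 'v) \<Rightarrow> ('v set \<Rightarrow> 'v) \<Rightarrow> bool" where
  "endpoint_listing E s t \<longleftrightarrow> (\<forall>e\<in>E. e = {s e, t e})"

definition graph_hamiltonian ::
  "'v set set \<Rightarrow> ('v set \<Rightarrow> 'v) \<Rightarrow> ('v set \<Rightarrow> 'v) \<Rightarrow> ('v set \<Rightarrow> complex^('d \<times> 'd)^('d \<times> 'd))
    \<Rightarrow> complex^('v::finite \<Rightarrow> 'd::finite)^('v \<Rightarrow> 'd)" where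
  "graph_hamiltonian E s t P = (\<Sum>e\<in>E. extend_op (s e) (t e) (P e))"

definition eigenvalue :: "complex^'n^'n \<Rightarrow> complex \<Rightarrow> bool" where
  "eigenvalue A c \<longleftrightarrow> (\<exists>v. v \<noteq> 0 \<and> A *v v = c *s v)"

definition spec :: "complex^'n^'n \<Rightarrow> complex set" where
  "spec A = {c. \<not> invertible (A - mat c)}"

text \<open>
  The smallest eigenvalue is \<open>0\<close>: it is an eigenvalue, and all eigenvalues are real and
  nonnegative.
\<close>

definition frustration_free :: "complex^'n^'n \<Rightarrow> bool" where
  "frustration_free H \<longleftrightarrow> eigenvalue H 0 \<and> (\<forall>c. eigenvalue H c \<longrightarrow> c \<in> \<real> \<and> 0 \<le> Re c)"

end

theory Submission
  imports Defs
begin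

text \<open>
  The argument is the quantum Lovasz local lemma of Ambainis, Kempe and Sattath. For a set \<open>S\<close> of
  edges let \<open>g S\<close> be the dimension of the common kernel of the projections \<open>P\<^sub>e\<close> with \<open>e \<in> S\<close>.
  The usual inductive proof of the local lemma only needs that \<open>g\<close> is supermodular and
  that adding an edge disjoint from all edges of \<open>S\<close> loses at most the fraction \<open>r / d\<^sup>2\<close> of \<open>g S\<close>.
  The latter holds because the common kernel is then a module over the full matrix algebra on the
  two sites of the new edge. As an edge meets at most \<open>2 * \<delta> - 2\<close> others, \<open>g E\<close> is positive.
\<close>

section \<open>The local lemma for supermodular set functions\<close>

lemma lovasz_local_lemma_supermodular:
  fixes g :: "'e set \<Rightarrow> real" and N :: "'e \<Rightarrow> 'e set"
  assumes fin: "finite E"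
    and nonneg: "\<And>S. 0 \<le> g S"
    and super: "\<And>e S T. g (insert e S) + g (S \<union> T) \<le> g S + g (insert e (S \<union> T))"
    and indep: "\<And>e S. e \<in> E \<Longrightarrow> S \<subseteq> E \<Longrightarrow> S \<inter> N e = {} \<Longrightarrow> g S \<le> g (insert e S) + p * g S"
    and x: "0 \<le> x" "x < 1"
    and p: "\<And>e. e \<in> E \<Longrightarrow> p \<le> x * (1 - x) ^ card (E \<inter> N e - {e})"
    and "S \<subseteq> E" "e \<in> E" "e \<notin> S"
  shows "(1 - x) * g S \<le> g (insert e S)"
  using \<open>S \<subseteq> E\<close> \<open>e \<in> E\<close> \<open>e \<notin> S\<close>
proof (induction "card S" arbitrary: S e rule: less_induct)
  case less
  have finS: "finite S" using less.prems fin by (meson finite_subset)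
  \<comment> \<open>Independence is available only over \<open>T\<close>; the neighbours of
    \<open>e\<close> in \<open>S\<close> are put back one at a time. Each costs a factor
    \<open>1 - x\<close> by the induction hypothesis, which applies because
    \<open>T \<union> F\<close> misses \<open>f\<close> and so is smaller than
    \<open>S\<close>.\<close>
  define T where "T = S - N e"
  have chain: "(1 - x) ^ card F * g T \<le> g (T \<union> F)" if "F \<subseteq> S \<inter> N e" for F
  proof -
    have "finite F" using that finS by (meson finite_Int finite_subset)
    then show ?thesis using that
    proof (induction F rule: finite_induct)
      case empty then show ?case by simp
    next
      case (insert f F)
      have f: "f \<in> S" "f \<in> E" "f \<notin> T \<union> F" and sub: "T \<union> F \<subseteq> S"
        using insert less.prems by (auto simp: T_def)
      then have "card (T \<union> F) < card S"
        using finS by (intro psubset_card_mono) auto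
      then have "(1 - x) * g (T \<union> F) \<le> g (insert f (T \<union> F))"
        using less.hyps[of "T \<union> F" f] f sub less.prems by auto
      moreover have "(1 - x) * ((1 - x) ^ card F * g T) \<le> (1 - x) * g (T \<union> F)"
        using insert x by (intro mult_left_mono) auto
      ultimately show ?case using insert by (simp add: mult.assoc)
    qed
  qed
  have S: "T \<union> S \<inter> N e = S" by (auto simp: T_def)
  \<comment> \<open>Supermodularity: the loss caused by \<open>e\<close> can only shrink as more
    edges are already present, so it is largest over \<open>T\<close>.\<close>
  have "g S - g (insert e S) \<le> g T - g (insert e T)"
    using super[of e T "S \<inter> N e"] unfolding S by simp
  also have "\<dots> \<le> p * g T"
  proof -
    have "T \<subseteq> E" "T \<inter> N e = {}" using less.prems by (auto simp: T_def)
    then show ?thesis using indep[of e T] less.prems by simp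
  qed
  also have "\<dots> \<le> x * (1 - x) ^ card (E \<inter> N e - {e}) * g T"
    using p less.prems nonneg by (intro mult_right_mono) auto
  \<comment> \<open>As \<open>e\<close> is not in \<open>S\<close>, the neighbours in
    \<open>S\<close> lie in \<open>E \<inter> N e - {e}\<close>; hence the exponent in the
    hypothesis on \<open>p\<close> may leave out \<open>e\<close> itself.\<close>
  also have "\<dots> \<le> x * (1 - x) ^ card (S \<inter> N e) * g T"
    using x nonneg less.prems fin
    by (intro mult_right_mono mult_left_mono power_decreasing card_mono) auto
  also have "\<dots> \<le> x * g S"
    using chain[of "S \<inter> N e"] x unfolding S by (simp add: mult.assoc mult_left_mono)
  finally show ?case by (simp add: algebra_simps)
qed

text \<open>Inserting the edges one by one multiplies \<open>g\<close> each time by at least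
  \<open>1 - x\<close>, which is positive.\<close>

corollary lovasz_local_lemma_supermodular_pos:
  fixes g :: "'e set \<Rightarrow> real" and N :: "'e \<Rightarrow> 'e set"
  assumes fin: "finite E"
    and nonneg: "\<And>S. 0 \<le> g S"
    and super: "\<And>e S T. g (insert e S) + g (S \<union> T) \<le> g S + g (insert e (S \<union> T))"
    and indep: "\<And>e S. e \<in> E \<Longrightarrow> S \<subseteq> E \<Longrightarrow> S \<inter> N e = {} \<Longrightarrow> g S \<le> g (insert e S) + p * g S"
    and x: "0 \<le> x" "x < 1"
    and p: "\<And>e. e \<in> E \<Longrightarrow> p \<le> x * (1 - x) ^ card (E \<inter> N e - {e})"
    and empty: "0 < g {}"
  shows "0 < g E"
proof -
  have "S \<subseteq> E \<Longrightarrow> 0 < g S" if "finite S" for S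
    using that
  proof (induction S rule: finite_induct)
    case (insert e S)
    then have "0 < (1 - x) * g S" using x by simp
    also have "\<dots> \<le> g (insert e S)"
      by (rule lovasz_local_lemma_supermodular[where E = E and N = N and p = p])
        (use assms insert in auto)
    finally show ?case .
  qed (use empty in simp)
  then show ?thesis using fin by simp
qed

text \<open>
  The local lemma is applied with \<open>x = 1 - exp (- c)\<close> rather than the customary \<open>x = c\<close>, which
  would give \<open>x = 1\<close> when \<open>\<delta> = 1\<close>.
\<close>

lemma symmetric_local_lemma_weight:
  fixes \<delta> :: real
  assumes "\<delta> \<ge> 1" "real k \<le> 2 * \<delta> - 2"
  defines "c \<equiv> 1 / (2 * \<delta> - 1)"
  shows "exp (-1) * c \<le> (1 - exp (- c)) * exp (- c) ^ k"
proof -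
  have c: "0 < c" "c * (2 * \<delta> - 2) = 1 - c"
    using assms by (auto simp: c_def field_simps)
  have "c \<le> exp c - 1"
    using exp_ge_add_one_self[of c] by linarith
  then have "exp (-1) * c \<le> exp (-1) * (exp c - 1)" by simp
  \<comment> \<open>Once \<open>x\<close> is factored out, only
    \<open>exp (c - 1) \<le> exp (- c) ^ k\<close> remains. It follows from
    \<open>c * k \<le> 1 - c\<close>, since \<open>2 * \<delta> - 2\<close> is
    \<open>1 / c - 1\<close>.\<close>
  also have "\<dots> = (1 - exp (- c)) * exp (c - 1)"
    by (simp add: exp_diff exp_minus field_simps)
  also have "\<dots> \<le> (1 - exp (- c)) * exp (- c) ^ k"
  proof (intro mult_left_mono)
    have "c * real k \<le> c * (2 * \<delta> - 2)" using c assms by (intro mult_left_mono) auto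
    then have "c - 1 \<le> real k * (- c)" using c by (simp only: mult_minus_right mult.commute)
    then show "exp (c - 1) \<le> exp (- c) ^ k" by (simp flip: exp_of_nat_mult)
  qed (use c in simp)
  finally show ?thesis .
qed

section \<open>Dimension bounds for kernels inside a subspace\<close>

text \<open>Rank-nullity for a restricted map: a basis \<open>B0\<close> of the kernel is extended
  to a basis \<open>B\<close> of \<open>W\<close>, and \<open>A\<close> is injective on the span of
  the added vectors.\<close>

lemma vec_dim_le_kernel_plus_image:
  fixes A :: "'a::field^'n^'m"
  assumes W: "vec.subspace W"
  shows "vec.dim W \<le> vec.dim (W \<inter> {w. A *v w = 0}) + vec.dim ((*v) A ` W)"
proof -
  define K where "K = W \<inter> {w. A *v w = 0}"
  have K: "vec.subspace K"
    using W by (auto simp: K_def vec.subspace_def matrix_vector_right_distrib vector_scalar_commute)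
  obtain B0 where B0: "B0 \<subseteq> K" "vec.independent B0" "K \<subseteq> vec.span B0" "card B0 = vec.dim K"
    using vec.basis_exists by blast
  have "B0 \<subseteq> W" using B0 by (auto simp: K_def)
  then obtain B where B: "B0 \<subseteq> B" "B \<subseteq> W" "vec.independent B" "W \<subseteq> vec.span B"
    using vec.maximal_independent_subset_extend[OF _ B0(2)] by blast
  have finB: "finite B" using B vec.finiteI_independent by blast
  have dimW: "vec.dim W = card B" using B vec.basis_card_eq_dim by metis
  define T where "T = vec.span (B - B0)"
  have indT: "vec.independent (B - B0)" using B vec.independent_mono by blast
  have dimT: "vec.dim T = card (B - B0)"
    unfolding T_def using indT by (rule vec.dim_span_eq_card_independent)
  \<comment> \<open>The sum of \<open>K\<close> and \<open>T\<close> contains \<open>W\<close>, so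
    the dimension formula for sums forces \<open>K \<inter> T\<close> to be trivial. This gives the
    injectivity of \<open>A\<close> on \<open>T\<close>.\<close>
  have "vec.dim W \<le> vec.dim {u + v |u v. u \<in> K \<and> v \<in> T}"
  proof (rule vec.dim_mono)
    have sub: "vec.subspace {u + v |u v. u \<in> K \<and> v \<in> T}"
      using K by (intro vec.subspace_sums) (auto simp: T_def)
    have "b \<in> {u + v |u v. u \<in> K \<and> v \<in> T}" if "b \<in> B" for b
    proof (cases "b \<in> B0")
      case True
      then have "b = b + 0 \<and> b \<in> K \<and> 0 \<in> T" using B0 by (auto simp: T_def vec.span_zero)
      then show ?thesis by blast
    next
      case False
      then have "b = 0 + b \<and> 0 \<in> K \<and> b \<in> T"
        using that K by (auto simp: T_def vec.span_base vec.subspace_0)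
      then show ?thesis by blast
    qed
    then have "vec.span B \<subseteq> {u + v |u v. u \<in> K \<and> v \<in> T}"
      using sub by (intro vec.span_minimal) auto
    then show "W \<subseteq> vec.span {u + v |u v. u \<in> K \<and> v \<in> T}"
      using B(4) vec.span_superset by blast
  qed
  then have "vec.dim (K \<inter> T) + card B \<le> card B0 + card (B - B0)"
    using vec.dim_sums_Int[OF K, of T] B0(4) dimT dimW by (simp add: T_def)
  then have "vec.dim (K \<inter> T) = 0"
    using B(1) finB by (simp add: card_Diff_subset finite_subset card_mono)
  then have KT: "K \<inter> T \<subseteq> {0}" by simp
  have TW: "T \<subseteq> W" unfolding T_def using B W by (intro vec.span_minimal) auto
  have "inj_on ((*v) A) T"
  proof (rule inj_onI)
    fix u v assume *: "u \<in> T" "v \<in> T" "A *v u = A *v v"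
    then have "u - v \<in> T" by (simp add: T_def vec.span_diff)
    moreover have "A *v (u - v) = 0" using * by (simp add: matrix_vector_mult_diff_distrib)
    ultimately show "u = v" using KT TW by (auto simp: K_def)
  qed
  then have "card (B - B0) = vec.dim ((*v) A ` (B - B0))"
    using vec.dim_image_eq[of "(*v) A" "B - B0"] indT
    by (simp add: T_def matrix_vector_mul_linear_gen vec.dim_eq_card_independent)
  also have "\<dots> \<le> vec.dim ((*v) A ` W)"
    using B by (intro vec.dim_subset) auto
  finally show ?thesis
    using B(1) B0(4) dimW finB unfolding K_def[symmetric]
    by (simp add: card_Diff_subset finite_subset)
qed

text \<open>The equations are imposed one after another; each image lies in \<open>U\<close>, so
  each equation costs at most \<open>vec.dim U\<close>.\<close>

lemma vec_dim_le_common_kernel: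
  fixes L :: "'b \<Rightarrow> 'a::field^'n^'m"
  assumes "finite B" and W: "vec.subspace W"
    and U: "\<And>b w. b \<in> B \<Longrightarrow> w \<in> W \<Longrightarrow> L b *v w \<in> U"
  shows "vec.dim W \<le> vec.dim (W \<inter> {w. \<forall>b\<in>B. L b *v w = 0}) + card B * vec.dim U"
  using \<open>finite B\<close> U
proof (induction B rule: finite_induct)
  case (insert b B)
  let ?W = "W \<inter> {w. \<forall>b\<in>B. L b *v w = 0}"
  have sub: "vec.subspace ?W"
    using W by (auto simp: vec.subspace_def matrix_vector_right_distrib vector_scalar_commute)
  have eq: "W \<inter> {w. \<forall>b\<in>insert b B. L b *v w = 0} = ?W \<inter> {w. L b *v w = 0}" by auto
  have "vec.dim ((*v) (L b) ` ?W) \<le> vec.dim U"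
    using insert.prems by (intro vec.dim_subset) auto
  then show ?case
    using insert vec_dim_le_kernel_plus_image[OF sub, of "L b"] unfolding eq by simp
qed simp

section \<open>Operators acting on two sites\<close>

text \<open>Row \<open>\<sigma>\<close> of the matrix is supported on configurations that agree with
  \<open>\<sigma>\<close> off the two sites, and the values \<open>c\<close> at these sites
  parametrize them bijectively.\<close>

lemma extend_op_mult_vec:
  fixes A :: "complex^('d::finite \<times> 'd)^('d \<times> 'd)" and w :: "complex^('v::finite \<Rightarrow> 'd)"
  assumes "x \<noteq> y"
  shows "(extend_op x y A *v w) $ \<sigma> =
    (\<Sum>c\<in>UNIV. A $ (\<sigma> x, \<sigma> y) $ c * w $ (\<sigma>(x := fst c, y := snd c)))"
proof -
  let ?h = "\<lambda>c. \<sigma>(x := fst c, y := snd c)"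
  let ?f = "\<lambda>\<tau>. extend_op x y A $ \<sigma> $ \<tau> * w $ \<tau>"
  have inj: "inj ?h"
  proof (rule injI)
    fix c c' assume "?h c = ?h c'"
    then have "?h c x = ?h c' x" "?h c y = ?h c' y" by simp_all
    then show "c = c'" using assms by (simp add: prod_eq_iff)
  qed
  have "\<tau> \<in> range ?h" if "\<forall>z. z \<noteq> x \<and> z \<noteq> y \<longrightarrow> \<sigma> z = \<tau> z" for \<tau>
    using that assms by (intro image_eqI[of _ _ "(\<tau> x, \<tau> y)"]) auto
  then have "sum ?f UNIV = sum ?f (range ?h)"
    by (intro sum.mono_neutral_right) (auto simp: extend_op_def)
  also have "\<dots> = (\<Sum>c\<in>UNIV. ?f (?h c))"
    using inj by (simp add: sum.reindex)
  also have "\<dots> = (\<Sum>c\<in>UNIV. A $ (\<sigma> x, \<sigma> y) $ c * w $ (?h c))"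
    using assms by (intro sum.cong) (auto simp: extend_op_def)
  finally show ?thesis by (simp add: matrix_vector_mult_def)
qed

lemma extend_op_mult_extend_op:
  fixes A B :: "complex^('d::finite \<times> 'd)^('d \<times> 'd)" and w :: "complex^('v::finite \<Rightarrow> 'd)"
  assumes "x \<noteq> y"
  shows "extend_op x y A *v (extend_op x y B *v w) = extend_op x y (A ** B) *v w"
proof (rule vec_eq_iff[THEN iffD2, rule_format])
  fix \<sigma>
  have "(extend_op x y A *v (extend_op x y B *v w)) $ \<sigma> =
    (\<Sum>c\<in>UNIV. \<Sum>c'\<in>UNIV. A $ (\<sigma> x, \<sigma> y) $ c * (B $ c $ c' * w $ (\<sigma>(x := fst c', y := snd c'))))"
    using assms by (simp add: extend_op_mult_vec sum_distrib_left fun_upd_twist[of x y])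
  also have "\<dots> = (\<Sum>c'\<in>UNIV. \<Sum>c\<in>UNIV. A $ (\<sigma> x, \<sigma> y) $ c * (B $ c $ c' * w $ (\<sigma>(x := fst c', y := snd c'))))"
    by (rule sum.swap)
  also have "\<dots> = (extend_op x y (A ** B) *v w) $ \<sigma>"
    using assms by (simp add: extend_op_mult_vec matrix_matrix_mult_def sum_distrib_right mult.assoc)
  finally show "(extend_op x y A *v (extend_op x y B *v w)) $ \<sigma> = (extend_op x y (A ** B) *v w) $ \<sigma>" .
qed

text \<open>Updates at disjoint pairs of sites commute, so both orders give the same double sum.
  This makes the common kernel of edges disjoint from \<open>e\<close> stable under every operator
  on \<open>e\<close>.\<close>

lemma extend_op_commute:
  fixes A B :: "complex^('d::finite \<times> 'd)^('d \<times> 'd)" and w :: "complex^('v::finite \<Rightarrow> 'd)"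
  assumes "x \<noteq> y" "x' \<noteq> y'" "{x, y} \<inter> {x', y'} = {}"
  shows "extend_op x y A *v (extend_op x' y' B *v w) = extend_op x' y' B *v (extend_op x y A *v w)"
proof (rule vec_eq_iff[THEN iffD2, rule_format])
  fix \<sigma> :: "'v \<Rightarrow> 'd"
  have ne: "x \<noteq> x'" "x \<noteq> y'" "y \<noteq> x'" "y \<noteq> y'" using assms by auto
  have upd: "\<sigma>(x := a, y := b, x' := a', y' := b') = \<sigma>(x' := a', y' := b', x := a, y := b)" for a b a' b'
    using assms by (auto simp: fun_eq_iff)
  have "(extend_op x y A *v (extend_op x' y' B *v w)) $ \<sigma> =
    (\<Sum>c\<in>UNIV. \<Sum>c'\<in>UNIV. A $ (\<sigma> x, \<sigma> y) $ c * (B $ (\<sigma> x', \<sigma> y') $ c' *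
      w $ (\<sigma>(x := fst c, y := snd c, x' := fst c', y' := snd c'))))"
    using assms by (simp add: ne ne[symmetric] extend_op_mult_vec sum_distrib_left)
  also have "\<dots> = (\<Sum>c'\<in>UNIV. \<Sum>c\<in>UNIV. A $ (\<sigma> x, \<sigma> y) $ c * (B $ (\<sigma> x', \<sigma> y') $ c' *
      w $ (\<sigma>(x := fst c, y := snd c, x' := fst c', y' := snd c'))))"
    by (rule sum.swap)
  also have "\<dots> = (extend_op x' y' B *v (extend_op x y A *v w)) $ \<sigma>"
    using assms by (simp add: ne ne[symmetric] extend_op_mult_vec sum_distrib_left upd mult.left_commute)
  finally show "(extend_op x y A *v (extend_op x' y' B *v w)) $ \<sigma>
    = (extend_op x' y' B *v (extend_op x y A *v w)) $ \<sigma>" .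
qed

section \<open>Matrix units and modules over the matrix algebra of two sites\<close>

definition matrix_unit :: "'n \<Rightarrow> 'n \<Rightarrow> 'a::zero_neq_one^'n^'n" where
  "matrix_unit i j = (\<chi> k l. if k = i \<and> l = j then 1 else 0)"

lemma matrix_unit_mult:
  fixes M :: "'a::semiring_1^'n^'n"
  shows "matrix_unit i j ** M = (\<chi> k. if k = i then M $ j else 0)"
proof -
  have "(matrix_unit i j ** M) $ k $ l = (if k = i then M $ j $ l else 0)" for k l
  proof -
    have "(matrix_unit i j ** M) $ k $ l = (\<Sum>m\<in>UNIV. if m = j then (if k = i then M $ j $ l else 0) else 0)"
      unfolding matrix_matrix_mult_def matrix_unit_def by (simp only: vec_lambda_beta, intro sum.cong) auto
    then show ?thesis by simp
  qed
  then show ?thesis by (simp add: vec_eq_iff)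
qed

lemma matrix_unit_mult_matrix_unit:
  "matrix_unit i j ** matrix_unit k l = (if j = k then matrix_unit i l else (0 :: 'a::semiring_1^'n^'n))"
  by (simp add: matrix_unit_mult) (simp add: matrix_unit_def vec_eq_iff)

lemma extend_op_zero [simp]: "extend_op x y 0 = 0"
  by (simp add: extend_op_def vec_eq_iff)

text \<open>
  \<open>W\<close> is a module over the full matrix algebra on the two sites, hence a direct sum of the
  \<open>d\<^sup>2\<close> mutually isomorphic ranges of the diagonal matrix units.
\<close>

lemma card_mult_dim_matrix_unit_le:
  fixes W :: "(complex^('v::finite \<Rightarrow> 'd::finite)) set"
  assumes xy: "x \<noteq> y" and W: "vec.subspace W"
    and inv: "\<And>A w. w \<in> W \<Longrightarrow> extend_op x y A *v w \<in> W"
  shows "CARD('d)\<^sup>2 * vec.dim ((*v) (extend_op x y (matrix_unit a a)) ` W) \<le> vec.dim W"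
proof -
  define U where "U = (*v) (extend_op x y (matrix_unit a a)) ` W"
  obtain B where B: "B \<subseteq> U" "vec.independent B" "U \<subseteq> vec.span B" "card B = vec.dim U"
    using vec.basis_exists by blast
  have finB: "finite B" using B vec.finiteI_independent by blast
  have BW: "B \<subseteq> W" using B inv by (auto simp: U_def)
  \<comment> \<open>The matrix unit \<open>(i, a)\<close> carries the basis \<open>B\<close> of the
    range of unit \<open>(a, a)\<close> into the range of unit \<open>(i, i)\<close>, giving one
    copy of \<open>B\<close> for each of the \<open>d^2\<close> indices \<open>i\<close>.\<close>
  define h where "h = (\<lambda>(i, b :: complex^('v \<Rightarrow> 'd)). extend_op x y (matrix_unit i a) *v b)"
  \<comment> \<open>Unit \<open>(a, j)\<close> reads off the \<open>j\<close>-th copy and kills the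
    others; \<open>b\<close> comes back unchanged because it lies in the range of the idempotent
    \<open>(a, a)\<close>. Injectivity of \<open>h\<close> and linear independence both rest on
    this.\<close>
  have coeff: "extend_op x y (matrix_unit a j) *v h (i, b) = (if i = j then b else 0)"
    if "b \<in> B" for i j b
  proof -
    have "b \<in> U" using that B(1) by blast
    then obtain w where "b = extend_op x y (matrix_unit a a) *v w" unfolding U_def by blast
    then show ?thesis
      by (simp add: h_def extend_op_mult_extend_op[OF xy] matrix_unit_mult_matrix_unit)
  qed
  have inj: "inj_on h (UNIV \<times> B)"
  proof (rule inj_onI, clarify)
    fix i b i' b' assume b: "b \<in> B" "b' \<in> B" and eq: "h (i, b) = h (i', b')"
    have "b \<noteq> 0" using b B vec.dependent_zero by blast
    have "b = (if i' = i then b' else 0)"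
      using coeff[OF b(1), of i i] coeff[OF b(2), of i i'] eq by simp
    then show "i = i' \<and> b = b'" using \<open>b \<noteq> 0\<close> by (auto split: if_splits)
  qed
  have "vec.independent (h ` (UNIV \<times> B))"
  proof (rule vec.independent_if_scalars_zero)
    fix f v assume eq: "(\<Sum>v\<in>h ` (UNIV \<times> B). f v *s v) = 0" and "v \<in> h ` (UNIV \<times> B)"
    then obtain j b where v: "v = h (j, b)" "b \<in> B" by auto
    have "0 = extend_op x y (matrix_unit a j) *v (\<Sum>q\<in>UNIV \<times> B. f (h q) *s h q)"
      using eq inj by (simp add: sum.reindex)
    also have "\<dots> = (\<Sum>q\<in>UNIV \<times> B. f (h q) *s (extend_op x y (matrix_unit a j) *v h q))"
      by (simp add: vec.linear_sum[OF matrix_vector_mul_linear_gen] vector_scalar_commute)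
    also have "\<dots> = (\<Sum>b'\<in>B. \<Sum>i\<in>UNIV. f (h (i, b')) *s (extend_op x y (matrix_unit a j) *v h (i, b')))"
      by (subst sum.swap) (simp add: sum.cartesian_product)
    also have "\<dots> = (\<Sum>b'\<in>B. \<Sum>i\<in>UNIV. if i = j then f (h (i, b')) *s b' else 0)"
      by (intro sum.cong refl) (simp add: coeff)
    also have "\<dots> = (\<Sum>b'\<in>B. f (h (j, b')) *s b')" by simp
    finally have "(\<Sum>b'\<in>B. f (h (j, b')) *s b') = 0" by simp
    then show "f v = 0"
      using vec.independentD[OF B(2) finB subset_refl, of "\<lambda>b'. f (h (j, b'))" b] v by simp
  qed (use finB in simp)
  moreover have "h ` (UNIV \<times> B) \<subseteq> W" using BW inv by (auto simp: h_def)
  ultimately have "card (h ` (UNIV \<times> B)) \<le> vec.dim W"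
    by (intro vec.independent_card_le_dim)
  then show ?thesis
    using inj B(4) by (simp add: card_image card_cartesian_product power2_eq_square U_def)
qed

text \<open>The equation \<open>A w = 0\<close> amounts to one equation for each vector in a basis
  of the row space, hence \<open>rank A\<close> of them. Each takes values in the range
  \<open>U\<close> of a diagonal matrix unit on \<open>W\<close>, whose dimension is at most
  \<open>vec.dim W / d^2\<close>.\<close>

lemma dim_le_dim_ker_extend_op:
  fixes W :: "(complex^('v::finite \<Rightarrow> 'd::finite)) set"
  assumes xy: "x \<noteq> y" and W: "vec.subspace W"
    and inv: "\<And>A w. w \<in> W \<Longrightarrow> extend_op x y A *v w \<in> W"
  shows "real (vec.dim W) \<le> real (vec.dim (W \<inter> {w. extend_op x y A *v w = 0}))
    + real (rank A) / (real CARD('d))\<^sup>2 * real (vec.dim W)"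
proof -
  fix a0 :: 'd
  define a where "a = (a0, a0)"
  define U where "U = (*v) (extend_op x y (matrix_unit a a)) ` W"
  obtain B where B: "B \<subseteq> rows A" "vec.independent B" "rows A \<subseteq> vec.span B" "card B = rank A"
    using vec.basis_exists unfolding row_rank_def_gen by blast
  have finB: "finite B" using B vec.finiteI_independent by blast
  \<comment> \<open>\<open>R b\<close> has \<open>b\<close> as its row \<open>a\<close> and zeros
    elsewhere. Multiplying by the unit \<open>(a, a)\<close> from the left therefore fixes it, which
    places its image of \<open>W\<close> in \<open>U\<close>.\<close>
  define R where "R = (\<lambda>b. (\<chi> i. if i = a then b else 0) :: complex^('d \<times> 'd)^('d \<times> 'd))"
  have R: "matrix_unit a a ** R b = R b" for b
    by (simp add: matrix_unit_mult R_def vec_eq_iff)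
  have "extend_op x y (R b) *v w \<in> U" if "w \<in> W" for b w
    using inv[OF that, of "R b"] unfolding U_def
    by (intro image_eqI[of _ _ "extend_op x y (R b) *v w"]) (simp_all add: extend_op_mult_extend_op[OF xy] R)
  then have dim: "vec.dim W \<le> vec.dim (W \<inter> {w. \<forall>b\<in>B. extend_op x y (R b) *v w = 0}) + rank A * vec.dim U"
    using vec_dim_le_common_kernel[OF finB W, of "\<lambda>b. extend_op x y (R b)" U] B by simp
  have "extend_op x y A *v w = 0" if w: "\<forall>b\<in>B. extend_op x y (R b) *v w = 0" for w
  proof (rule vec_eq_iff[THEN iffD2, rule_format])
    fix \<sigma>
    \<comment> \<open>The row vectors orthogonal (without conjugation) to the slice of
      \<open>w\<close> at \<open>\<sigma>\<close> form a subspace. It contains \<open>B\<close>,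
      hence every row of \<open>A\<close>.\<close>
    let ?Z = "{\<rho> :: complex^('d \<times> 'd). (\<Sum>c\<in>UNIV. \<rho> $ c * w $ (\<sigma>(x := fst c, y := snd c))) = 0}"
    have "vec.subspace ?Z"
      by (auto simp: vec.subspace_def distrib_right sum.distrib mult.assoc simp flip: sum_distrib_left)
    moreover have "B \<subseteq> ?Z"
    proof
      fix b assume "b \<in> B"
      \<comment> \<open>The two sites are set to \<open>a\<close> to select the only row of
        \<open>R b\<close> that can be nonzero; the sum then overwrites these values, so the slice
        is still that of \<open>\<sigma>\<close>.\<close>
      then have "(extend_op x y (R b) *v w) $ (\<sigma>(x := fst a, y := snd a)) = 0" using w by simp
      then show "b \<in> ?Z"
        using xy by (simp add: extend_op_mult_vec R_def fun_upd_twist[of x y])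
    qed
    ultimately have "vec.span B \<subseteq> ?Z" by (intro vec.span_minimal)
    moreover have "A $ (\<sigma> x, \<sigma> y) \<in> rows A" by (auto simp: rows_def row_def vec_lambda_eta)
    ultimately have "A $ (\<sigma> x, \<sigma> y) \<in> ?Z" using B(3) by blast
    then show "(extend_op x y A *v w) $ \<sigma> = 0 $ \<sigma>"
      using xy by (simp add: extend_op_mult_vec)
  qed
  then have "vec.dim (W \<inter> {w. \<forall>b\<in>B. extend_op x y (R b) *v w = 0}) \<le> vec.dim (W \<inter> {w. extend_op x y A *v w = 0})"
    by (intro vec.dim_subset) auto
  with dim have *: "vec.dim W \<le> vec.dim (W \<inter> {w. extend_op x y A *v w = 0}) + rank A * vec.dim U"
    by simp
  have "(real CARD('d))\<^sup>2 * real (vec.dim U) \<le> real (vec.dim W)"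
    using card_mult_dim_matrix_unit_le[OF xy W inv, of a]
    unfolding U_def by (metis of_nat_le_iff of_nat_mult of_nat_power)
  then have "real (vec.dim U) \<le> real (vec.dim W) / (real CARD('d))\<^sup>2"
    by (simp add: field_simps)
  then have "real (rank A) * real (vec.dim U) \<le> real (rank A) * (real (vec.dim W) / (real CARD('d))\<^sup>2)"
    by (intro mult_left_mono) auto
  moreover have "real (vec.dim W) \<le> real (vec.dim (W \<inter> {w. extend_op x y A *v w = 0})) + real (rank A) * real (vec.dim U)"
    using * by (metis of_nat_add of_nat_le_iff of_nat_mult)
  ultimately show ?thesis by simp
qed

section \<open>The spectrum of a sum of orthogonal projections\<close>

lemma orthogonal_projection_extend_op:
  assumes "x \<noteq> y" "orthogonal_projection A"
  shows "orthogonal_projection (extend_op x y A)"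
proof -
  have "extend_op x y A *v (extend_op x y A *v w) = extend_op x y A *v w" for w
    unfolding extend_op_mult_extend_op[OF assms(1)] using assms(2)
    by (simp add: orthogonal_projection_def)
  then have "extend_op x y A ** extend_op x y A = extend_op x y A"
    by (simp add: matrix_eq matrix_vector_mul_assoc)
  moreover have "cnj (A $ j $ i) = A $ i $ j" for i j
  proof -
    have "hermitian_adjoint A $ i $ j = A $ i $ j"
      using assms by (simp add: orthogonal_projection_def)
    then show ?thesis by (simp add: hermitian_adjoint_def map_matrix_def transpose_def)
  qed
  then have "hermitian_adjoint (extend_op x y A) = extend_op x y A"
    by (auto simp: vec_eq_iff hermitian_adjoint_def map_matrix_def transpose_def extend_op_def)
  ultimately show ?thesis by (simp add: orthogonal_projection_def)
qed

text \<open>A projection equals its adjoint times itself, so its quadratic form is the squared norm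
  of the image.\<close>

lemma orthogonal_projection_quadratic_form:
  fixes Q :: "complex^'n^'n"
  assumes "orthogonal_projection Q"
  shows "(\<Sum>i\<in>UNIV. cnj (v $ i) * (Q *v v) $ i) = of_real (\<Sum>i\<in>UNIV. (cmod ((Q *v v) $ i))\<^sup>2)"
proof -
  have herm: "cnj (Q $ i $ j) = Q $ j $ i" for i j
  proof -
    have "hermitian_adjoint Q $ j $ i = Q $ j $ i"
      using assms by (simp add: orthogonal_projection_def)
    then show ?thesis by (simp add: hermitian_adjoint_def map_matrix_def transpose_def)
  qed
  have "cnj ((Q *v v) $ i) = (\<Sum>j\<in>UNIV. cnj (v $ j) * Q $ j $ i)" for i
    by (simp add: matrix_vector_mult_def herm mult.commute)
  then have "(\<Sum>i\<in>UNIV. cnj ((Q *v v) $ i) * (Q *v v) $ i)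
    = (\<Sum>i\<in>UNIV. \<Sum>j\<in>UNIV. cnj (v $ j) * (Q $ j $ i * (Q *v v) $ i))"
    by (simp add: sum_distrib_right mult.assoc)
  also have "\<dots> = (\<Sum>j\<in>UNIV. \<Sum>i\<in>UNIV. cnj (v $ j) * (Q $ j $ i * (Q *v v) $ i))"
    by (rule sum.swap)
  also have "\<dots> = (\<Sum>j\<in>UNIV. cnj (v $ j) * (Q *v (Q *v v)) $ j)"
    by (simp add: matrix_vector_mult_def[of Q "Q *v v"] sum_distrib_left)
  also have "Q *v (Q *v v) = Q *v v"
    using assms by (simp add: matrix_vector_mul_assoc orthogonal_projection_def)
  finally show ?thesis
    by (simp add: complex_norm_square mult.commute del: of_real_power)
qed

text \<open>Pairing the eigenvalue equation with \<open>v\<close> exhibits \<open>c\<close> as the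
  quotient of \<open>q\<close>, a sum of squared norms, by the squared norm \<open>n\<close> of
  \<open>v\<close>.\<close>

lemma eigenvalue_sum_projections_nonneg:
  fixes Q :: "'e \<Rightarrow> complex^'n^'n"
  assumes Q: "\<And>e. e \<in> E \<Longrightarrow> orthogonal_projection (Q e)"
    and ev: "eigenvalue (\<Sum>e\<in>E. Q e) c"
  shows "c \<in> \<real> \<and> 0 \<le> Re c"
proof -
  obtain v where v: "v \<noteq> 0" "(\<Sum>e\<in>E. Q e) *v v = c *s v"
    using ev by (auto simp: eigenvalue_def)
  define n where "n = (\<Sum>i\<in>UNIV. (cmod (v $ i))\<^sup>2)"
  define q where "q = (\<Sum>e\<in>E. \<Sum>i\<in>UNIV. (cmod ((Q e *v v) $ i))\<^sup>2)"
  have sum_mult: "(\<Sum>e\<in>E. Q e) *v v = (\<Sum>e\<in>E. Q e *v v)"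
    by (induction E rule: infinite_finite_induct) (auto simp: matrix_vector_mult_add_rdistrib)
  obtain k where "v $ k \<noteq> 0" using v by (auto simp: vec_eq_iff)
  then have "0 < n" unfolding n_def by (intro sum_pos2[of _ k]) auto
  have "c * of_real n = (\<Sum>i\<in>UNIV. cnj (v $ i) * (c *s v) $ i)"
    by (simp add: n_def complex_norm_square sum_distrib_left mult_ac del: of_real_power)
  also have "\<dots> = (\<Sum>i\<in>UNIV. \<Sum>e\<in>E. cnj (v $ i) * (Q e *v v) $ i)"
    unfolding v(2)[symmetric] sum_mult by (simp add: sum_distrib_left)
  also have "\<dots> = (\<Sum>e\<in>E. \<Sum>i\<in>UNIV. cnj (v $ i) * (Q e *v v) $ i)" by (rule sum.swap)
  also have "\<dots> = of_real q"
    using Q by (simp add: orthogonal_projection_quadratic_form q_def)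
  finally have "c = of_real (q / n)" using \<open>0 < n\<close> by (simp add: field_simps)
  moreover have "0 \<le> q" unfolding q_def by (intro sum_nonneg) auto
  ultimately show ?thesis using \<open>0 < n\<close> by simp
qed

text \<open>In finite dimension a square matrix with trivial kernel is invertible.\<close>

lemma mem_spec_iff_eigenvalue:
  fixes A :: "complex^'n^'n"
  shows "c \<in> spec A \<longleftrightarrow> eigenvalue A c"
proof -
  have "mat c *v v = c *s v" for v :: "complex^'n"
  proof -
    have "(mat c *v v) $ i = (\<Sum>j\<in>UNIV. if j = i then c * v $ i else 0)" for i
      unfolding matrix_vector_mult_def mat_def by (simp only: vec_lambda_beta, intro sum.cong) auto
    then show ?thesis by (simp add: vec_eq_iff)
  qed
  then have "(A - mat c) *v v = 0 \<longleftrightarrow> A *v v = c *s v" for v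
    by (simp add: matrix_vector_mult_diff_rdistrib)
  then show ?thesis
    unfolding spec_def eigenvalue_def mem_Collect_eq invertible_left_inverse matrix_left_invertible_ker
    by auto
qed

lemma Inf_Re_spec_frustration_free:
  assumes "frustration_free H"
  shows "Inf (Re ` spec H) = 0"
proof (rule cInf_eq_minimum)
  show "0 \<in> Re ` spec H"
    using assms by (auto simp: frustration_free_def mem_spec_iff_eigenvalue intro!: image_eqI[of _ _ 0])
qed (use assms in \<open>auto simp: frustration_free_def mem_spec_iff_eigenvalue\<close>)

section \<open>Counting adjacent edges and finding a common kernel vector\<close>

text \<open>A neighbour of \<open>e\<close> contains \<open>x\<close> or \<open>y\<close>. Each
  endpoint has at most \<open>\<delta> - 1\<close> edges besides \<open>e\<close>, as
  \<open>e\<close> itself counts towards its degree.\<close>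

lemma card_adjacent_edges_le:
  fixes E :: "'v::finite set set"
  assumes "e \<in> E" "e = {x, y}" "real (vertex_degree E x) \<le> \<delta>" "real (vertex_degree E y) \<le> \<delta>"
  shows "real (card (E \<inter> {f. f \<inter> e \<noteq> {}} - {e})) \<le> 2 * \<delta> - 2"
proof -
  have deg: "real (card ({f \<in> E. z \<in> f} - {e})) \<le> \<delta> - 1"
    if "z \<in> e" "real (vertex_degree E z) \<le> \<delta>" for z
  proof -
    have "e \<in> {f \<in> E. z \<in> f}" using assms(1) that by simp
    then have "0 < card {f \<in> E. z \<in> f}" by (auto simp: card_gt_0_iff)
    then show ?thesis
      using that assms(1) by (simp add: vertex_degree_def card_Diff_singleton of_nat_diff)
  qed
  have "E \<inter> {f. f \<inter> e \<noteq> {}} - {e} = ({f \<in> E. x \<in> f} - {e}) \<union> ({f \<in> E. y \<in> f} - {e})"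
    using assms(2) by auto
  then have "card (E \<inter> {f. f \<inter> e \<noteq> {}} - {e}) \<le> card ({f \<in> E. x \<in> f} - {e}) + card ({f \<in> E. y \<in> f} - {e})"
    by (simp only: card_Un_le)
  then show ?thesis using deg[of x] deg[of y] assms by simp
qed

theorem lemma2p4:
  fixes E :: "'v::finite set set"
    and s t :: "'v set \<Rightarrow> 'v"
    and P :: "'v set \<Rightarrow> complex^('d::finite \<times> 'd)^('d \<times> 'd)"
    and \<delta> :: real and r :: nat
  assumes "simple_graph E"
    and "\<delta> \<ge> 1" and "\<forall>v. real (vertex_degree E v) \<le> \<delta>"
    and "CARD('d) \<ge> 2" and "r \<ge> 1"
    and "real r \<le> exp (-1) / (2 * \<delta> - 1) * (real CARD('d))\<^sup>2"
    and "endpoint_listing E s t"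
    and "\<forall>e\<in>E. orthogonal_projection (P e) \<and> rank (P e) = r"
  shows "frustration_free (graph_hamiltonian E s t P)
    \<and> Inf (Re ` spec (graph_hamiltonian E s t P)) = 0"
proof -
  define Q where "Q e = extend_op (s e) (t e) (P e)" for e
  have ends: "e = {s e, t e}" "s e \<noteq> t e" if "e \<in> E" for e
  proof -
    show *: "e = {s e, t e}" using assms(7) that by (simp add: endpoint_listing_def)
    have "card e = 2" using assms(1) that by (simp add: simple_graph_def)
    then have "card {s e, t e} = 2" using * by simp
    then show "s e \<noteq> t e" by auto
  qed
  have Q: "orthogonal_projection (Q e)" if "e \<in> E" for e
    unfolding Q_def using assms(8) ends that by (intro orthogonal_projection_extend_op) auto
  define W where "W S = {w. \<forall>e\<in>S. Q e *v w = 0}" for S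
  define g where "g S = real (vec.dim (W S))" for S
  have subW: "vec.subspace (W S)" for S
    by (auto simp: W_def vec.subspace_def matrix_vector_right_distrib vector_scalar_commute)
  define c where "c = 1 / (2 * \<delta> - 1)"
  have "0 < g E"
  proof (rule lovasz_local_lemma_supermodular_pos[where N = "\<lambda>e. {f. f \<inter> e \<noteq> {}}"
        and x = "1 - exp (- c)" and p = "real r / (real CARD('d))\<^sup>2"])
    fix e S T
    \<comment> \<open>Supermodularity is the dimension formula: the two kernels have their sum
      inside \<open>W S\<close> and meet exactly in
      \<open>W (insert e (S \<union> T))\<close>.\<close>
    have "{u + v |u v. u \<in> W (insert e S) \<and> v \<in> W (S \<union> T)} \<subseteq> W S"
      by (auto simp: W_def matrix_vector_right_distrib)
    then have "vec.dim {u + v |u v. u \<in> W (insert e S) \<and> v \<in> W (S \<union> T)} \<le> vec.dim (W S)"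
      by (rule vec.dim_subset)
    moreover have "W (insert e S) \<inter> W (S \<union> T) = W (insert e (S \<union> T))"
      by (auto simp: W_def)
    ultimately show "g (insert e S) + g (S \<union> T) \<le> g S + g (insert e (S \<union> T))"
      using vec.dim_sums_Int[OF subW subW, of "insert e S" "S \<union> T"] by (simp add: g_def)
  next
    fix e S assume e: "e \<in> E" and S: "S \<subseteq> E" "S \<inter> {f. f \<inter> e \<noteq> {}} = {}"
    \<comment> \<open>\<open>W S\<close> is a module over all operators on \<open>e\<close>, since
      these commute with each \<open>Q f\<close> for \<open>f\<close> in \<open>S\<close>.\<close>
    have "extend_op (s e) (t e) A *v w \<in> W S" if "w \<in> W S" for A w
      unfolding W_def
    proof (intro CollectI ballI)
      fix f assume f: "f \<in> S"
      then have "f \<in> E" "f \<inter> e = {}" using S by auto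
      then have "{s f, t f} \<inter> {s e, t e} = {}" using ends(1) e by metis
      then have "Q f *v (extend_op (s e) (t e) A *v w) = extend_op (s e) (t e) A *v (Q f *v w)"
        unfolding Q_def using ends(2) e \<open>f \<in> E\<close> by (intro extend_op_commute) auto
      then show "Q f *v (extend_op (s e) (t e) A *v w) = 0"
        using that f by (simp add: W_def)
    qed
    then have "real (vec.dim (W S)) \<le> real (vec.dim (W S \<inter> {w. Q e *v w = 0}))
      + real (rank (P e)) / (real CARD('d))\<^sup>2 * real (vec.dim (W S))"
      unfolding Q_def using ends(2)[OF e] subW by (intro dim_le_dim_ker_extend_op) auto
    moreover have "W S \<inter> {w. Q e *v w = 0} = W (insert e S)" by (auto simp: W_def)
    ultimately show "g S \<le> g (insert e S) + real r / (real CARD('d))\<^sup>2 * g S"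
      using assms(8) e by (simp add: g_def)
  next
    fix e assume e: "e \<in> E"
    have "real r / (real CARD('d))\<^sup>2 \<le> exp (-1) * c"
      using assms(6) by (simp add: c_def field_simps)
    also have "\<dots> \<le> (1 - exp (- c)) * exp (- c) ^ card (E \<inter> {f. f \<inter> e \<noteq> {}} - {e})"
      unfolding c_def using assms(2,3) ends(1)[OF e] e
      by (intro symmetric_local_lemma_weight card_adjacent_edges_le) auto
    finally show "real r / (real CARD('d))\<^sup>2
      \<le> (1 - exp (- c)) * (1 - (1 - exp (- c))) ^ card (E \<inter> {f. f \<inter> e \<noteq> {}} - {e})" by simp
  next
    \<comment> \<open>With no constraints the kernel is the whole space, of positive
      dimension.\<close>
    show "0 < g {}" by (simp add: g_def W_def card_cart_basis)
  qed (use assms(2) in \<open>auto simp: g_def c_def\<close>)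
  then have "vec.dim (W E) \<noteq> 0" by (simp only: g_def of_nat_0_less_iff neq0_conv)
  then have "\<not> W E \<subseteq> {0}" unfolding vec.dim_eq_0 .
  then obtain v where v: "v \<noteq> 0" "\<And>e. e \<in> E \<Longrightarrow> Q e *v v = 0" by (auto simp: W_def)
  have H: "graph_hamiltonian E s t P = (\<Sum>e\<in>E. Q e)"
    by (simp add: graph_hamiltonian_def Q_def)
  \<comment> \<open>A common kernel vector of all the projections is annihilated by their sum, so it
    is an eigenvector for the value zero.\<close>
  have "(\<Sum>e\<in>F. Q e) *v v = 0" if "F \<subseteq> E" for F
    using that v(2) by (induction F rule: infinite_finite_induct) (auto simp: matrix_vector_mult_add_rdistrib)
  then have "eigenvalue (\<Sum>e\<in>E. Q e) 0"
    using v(1) by (auto simp: eigenvalue_def)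
  then have "frustration_free (graph_hamiltonian E s t P)"
    unfolding frustration_free_def H using eigenvalue_sum_projections_nonneg Q by blast
  then show ?thesis using Inf_Re_spec_frustration_free by blast
qed

end
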